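(* Let $X$ be a complete metric space satisfying the finite doubling property. Then $X$ is uniformly perfect if and only if there exists a reverse-doubling measure $\mu$ supported on $X$.
   Context: Let $X=(X,d)$ be a metric space, always assumed to contain at least two points. Balls are closed: $B(x,r)=\{y\in X: d(x,y)\le r\}$. Finite doubling property: every ball $B(x,2r)\subset X$ can be covered by finitely many balls of radius $r$. Uniformly perfect: there is a constant $C\ge 1$ such that for every $x\in X$ and $r>0$ one has $B(x,r)\setminus B(x,r/C)\ne\emptyset$ whenever $X\setminus B(x,r)\neq\emptyset$. Measure: a nontrivial Borel regular outer measure on $X$ for which bounded sets have finite measure. A measure $\mu$ is supported on $X$ if its support is the whole of $X$, i.e. every ball of positive radius has positive measure. Reverse-doubling: a measure $\mu$ on $X$ is reverse-doubling if there exist constants $c>1$ and $\tau>1$ such that $\mu(B(x,\tau r))\ge c\,\mu(B(x,r))$ whenever $x\in X$ and $0<r\le \operatorname{diam}(X)/(2\tau)$. *)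

theory Defs
  imports "HOL-Analysis.Analysis"
begin

text \<open>
  A metric space is rendered as a type of class \<^class>\<open>metric_space\<close>, so that a property of the
  whole space takes the type as its argument.
\<close>

definition finitely_doubling :: "'a::metric_space itself \<Rightarrow> bool" where
  "finitely_doubling T \<longleftrightarrow>
     (\<forall>(x::'a) r. r > 0 \<longrightarrow> (\<exists>F. finite F \<and> cball x (2 * r) \<subseteq> (\<Union>y\<in>F. cball y r)))"

definition uniformly_perfect :: "'a::metric_space itself \<Rightarrow> bool" where
  "uniformly_perfect T \<longleftrightarrow>
     (\<exists>C\<ge>1. \<forall>(x::'a) r. r > 0 \<longrightarrow> UNIV - cball x r \<noteq> {} \<longrightarrow> cball x r - cball x (r / C) \<noteq> {})"

text \<open>
  The diameter of the space as an extended number: the library's \<^const>\<open>diameter\<close> is real-valued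
  and has no meaningful value on an unbounded set.
\<close>

definition ediam :: "'a::metric_space itself \<Rightarrow> ennreal" where
  "ediam T = (SUP (x::'a, y) \<in> UNIV. ennreal (dist x y))"

text \<open>
  The library's \<^const>\<open>countably_subadditive\<close>, which is part of \<^const>\<open>outer_measure_space\<close>, only
  speaks of disjoint families; for a monotone function on all subsets this is the same as
  subadditivity for arbitrary sequences. The set \<^term>\<open>lambda_system UNIV (Pow UNIV) \<mu>\<close> consists
  of the Caratheodory measurable sets of \<open>\<mu>\<close>.
\<close>

definition borel_regular_outer_measure :: "('a::topological_space set \<Rightarrow> ennreal) \<Rightarrow> bool" where
  "borel_regular_outer_measure \<mu> \<longleftrightarrow>
     outer_measure_space (Pow UNIV) \<mu> \<and>
     sets borel \<subseteq> lambda_system UNIV (Pow UNIV) \<mu> \<and>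
     (\<forall>A. \<exists>B\<in>sets borel. A \<subseteq> B \<and> \<mu> B = \<mu> A)"

text \<open>The standing notion of a measure on a metric space.\<close>

definition metric_measure :: "('a::metric_space set \<Rightarrow> ennreal) \<Rightarrow> bool" where
  "metric_measure \<mu> \<longleftrightarrow>
     borel_regular_outer_measure \<mu> \<and> \<mu> UNIV \<noteq> 0 \<and> (\<forall>A. bounded A \<longrightarrow> \<mu> A < \<infinity>)"

definition fully_supported :: "('a::metric_space set \<Rightarrow> ennreal) \<Rightarrow> bool" where
  "fully_supported \<mu> \<longleftrightarrow> (\<forall>x r. r > 0 \<longrightarrow> \<mu> (cball x r) > 0)"

definition reverse_doubling :: "('a::metric_space set \<Rightarrow> ennreal) \<Rightarrow> bool" where
  "reverse_doubling \<mu> \<longleftrightarrow>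
     (\<exists>(c::real) (\<tau>::real). c > 1 \<and> \<tau> > 1 \<and>
        (\<forall>x r. 0 < r \<longrightarrow> ennreal r \<le> ediam TYPE('a) / ennreal (2 * \<tau>) \<longrightarrow>
           \<mu> (cball x (\<tau> * r)) \<ge> ennreal c * \<mu> (cball x r)))"

end

(*
  If mu is reverse-doubling and fully supported, then mu (B(x, r / 2)) > mu (B(x, r / (2 tau))),
  so the annulus between the two balls is not empty.

  Conversely, the reverse-doubling inequality with fixed constants c, tau is preserved by countable
  positive combinations, and a measure with small support satisfies it trivially away from that
  support. Hence it is enough to find, for every z in a countable dense set and with uniform
  constants, a reverse-doubling measure that charges all balls around z.
  At scales below s such a measure is a Cantor measure, the image of Lebesgue measure on [0,1) under
  a binary tree of points: a node p of level k has the children p and w, with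
  s_k / C < d(p, w) <= s_k and s_k = s (8 C)^(-k). A ball of radius r < s_k / (4 C) meets only one of
  the two branches below a node of level k, so it carries at most half of the mass of every node
  that it meets, while its enlargement contains all of that mass.
  If X is bounded, s = diam X / 3 suffices. Otherwise one sums 2^n times Cantor measures of scale
  2^n / (4 C) around points y_n with d(z, y_n) comparable to 2^n: for a ball of radius comparable to
  2^N, the terms n < N, to which the Cantor estimate does not apply, have total mass less than 2^N,
  and the enlarged ball contains the whole N-th term.
*)

theory Submission
  imports Defs
begin

section \<open>Preliminaries on measures and covers\<close>

text \<open>The outer measure of any set is attained by a measurable hull. Passing to hulls reduces
  subadditivity and the Caratheodory splitting to the corresponding facts for
  \<open>emeasure M\<close>, and the hull itself is the Borel set that regularity asks for.\<close>

lemma borel_regular_outer_measure_of: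
  assumes "sets M = sets borel"
  shows "borel_regular_outer_measure (outer_measure_of M)"
proof -
  have sp: "space M = UNIV"
    using sets_eq_imp_space_eq[OF assms] by simp
  have attain: "\<exists>E\<in>sets M. A \<subseteq> E \<and> outer_measure_of M A = emeasure M E" for A
    by (rule outer_measure_of_attain) (simp add: sp)
  have subadd: "outer_measure_of M (\<Union>i. A i) \<le> (\<Sum>i. outer_measure_of M (A i))" for A :: "nat \<Rightarrow> _"
  proof -
    obtain E where E: "\<And>i. E i \<in> sets M" "\<And>i. A i \<subseteq> E i"
        "\<And>i. outer_measure_of M (A i) = emeasure M (E i)"
      using attain[of "A _"] by metis
    have "outer_measure_of M (\<Union>i. A i) \<le> outer_measure_of M (\<Union>i. E i)"
      using E(2) by (intro outer_measure_of_mono) blast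
    also have "\<dots> = emeasure M (\<Union>i. E i)"
      using E(1) by (intro outer_measure_of_eq) blast
    also have "\<dots> \<le> (\<Sum>i. emeasure M (E i))"
      using E(1) by (intro emeasure_subadditive_countably) auto
    finally show ?thesis by (simp add: E(3))
  qed
  have split: "outer_measure_of M (l \<inter> x) + outer_measure_of M ((UNIV - l) \<inter> x) = outer_measure_of M x"
    if l: "l \<in> sets borel" for l x
  proof (rule antisym)
    from l have l': "l \<in> sets M" by (simp add: assms)
    obtain E where E: "E \<in> sets M" "x \<subseteq> E" "outer_measure_of M x = emeasure M E"
      using attain by blast
    have "outer_measure_of M (l \<inter> x) + outer_measure_of M ((UNIV - l) \<inter> x)
        \<le> outer_measure_of M (E \<inter> l) + outer_measure_of M (E - l)"
      using E by (intro add_mono outer_measure_of_mono) auto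
    also have "\<dots> = emeasure M (E \<inter> l) + emeasure M (E - l)"
      using E l' by (simp add: sets.Int sets.Diff)
    also have "\<dots> = emeasure M ((E \<inter> l) \<union> (E - l))"
      using E l' by (intro plus_emeasure) auto
    also have "(E \<inter> l) \<union> (E - l) = E" by blast
    finally show "outer_measure_of M (l \<inter> x) + outer_measure_of M ((UNIV - l) \<inter> x) \<le> outer_measure_of M x"
      by (simp add: E(3))
  next
    obtain E F where E: "E \<in> sets M" "l \<inter> x \<subseteq> E" "outer_measure_of M (l \<inter> x) = emeasure M E"
      and F: "F \<in> sets M" "(UNIV - l) \<inter> x \<subseteq> F" "outer_measure_of M ((UNIV - l) \<inter> x) = emeasure M F"
      using attain by meson
    have "outer_measure_of M x \<le> outer_measure_of M (E \<union> F)"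
      using E F by (intro outer_measure_of_mono) blast
    also have "\<dots> = emeasure M (E \<union> F)" using E F by (simp add: sets.Un)
    also have "\<dots> \<le> emeasure M E + emeasure M F" using E F by (intro emeasure_subadditive)
    finally show "outer_measure_of M x \<le> outer_measure_of M (l \<inter> x) + outer_measure_of M ((UNIV - l) \<inter> x)"
      by (simp add: E(3) F(3))
  qed
  show ?thesis
    unfolding borel_regular_outer_measure_def outer_measure_space_def positive_def increasing_def
      countably_subadditive_def lambda_system_def
    using attain subadd split by (auto intro: outer_measure_of_mono simp: assms[symmetric]) metis+
qed

lemma suminf_commute_ennreal:
  fixes f :: "nat \<Rightarrow> nat \<Rightarrow> ennreal"
  shows "(\<Sum>i. \<Sum>j. f i j) = (\<Sum>j. \<Sum>i. f i j)"
proof -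
  have "(\<Sum>i. \<Sum>j. f i j) = (\<integral>\<^sup>+i. (\<Sum>j. f i j) \<partial>count_space UNIV)"
    by (simp add: nn_integral_count_space_nat)
  also have "\<dots> = (\<Sum>j. \<integral>\<^sup>+i. f i j \<partial>count_space UNIV)"
    by (intro nn_integral_suminf) simp
  finally show ?thesis by (simp add: nn_integral_count_space_nat)
qed

text \<open>Serves twice: to add Cantor measures at scales growing to infinity, and to add measures
  attached to the points of a dense sequence. Countable additivity is an exchange of two sums of
  nonnegative terms.\<close>

lemma countable_sum_measure:
  fixes N :: "nat \<Rightarrow> 'a measure" and e :: "nat \<Rightarrow> ennreal"
  assumes "\<And>n. sets (N n) = sets S"
  obtains M where "sets M = sets S" "\<And>A. A \<in> sets S \<Longrightarrow> emeasure M A = (\<Sum>n. e n * emeasure (N n) A)"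
proof
  let ?f = "\<lambda>A. \<Sum>n. e n * emeasure (N n) A"
  let ?M = "measure_of (space S) (sets S) ?f"
  show "sets ?M = sets S" by (simp add: sets.sigma_sets_eq sets.space_closed)
  fix A assume "A \<in> sets S"
  show "emeasure ?M A = ?f A"
  proof (rule emeasure_measure_of_sigma)
    show "sigma_algebra (space S) (sets S)" by (rule sets.sigma_algebra_axioms)
    show "positive (sets S) ?f" by (simp add: positive_def)
    show "countably_additive (sets S) ?f"
      unfolding countably_additive_def
    proof safe
      fix A :: "nat \<Rightarrow> 'a set"
      assume A: "range A \<subseteq> sets S" "disjoint_family A"
      have "(\<Sum>i. ?f (A i)) = (\<Sum>n. \<Sum>i. e n * emeasure (N n) (A i))"
        by (rule suminf_commute_ennreal)
      also have "\<dots> = (\<Sum>n. e n * (\<Sum>i. emeasure (N n) (A i)))" by simp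
      also have "\<dots> = ?f (\<Union>i. A i)"
        using A assms by (subst suminf_emeasure) auto
      finally show "(\<Sum>i. ?f (A i)) = ?f (\<Union>i. A i)" .
    qed
  qed fact
qed

section \<open>Finite covers and separability\<close>

lemma finitely_doubling_cover:
  assumes "finitely_doubling TYPE('a::metric_space)" "r > 0"
  shows "\<exists>F. finite F \<and> cball (x::'a) r \<subseteq> (\<Union>y\<in>F. cball y (r / 2 ^ k))"
proof (induction k)
  case 0
  show ?case by (rule exI[of _ "{x}"]) simp
next
  case (Suc k)
  then obtain F where F: "finite F" "cball x r \<subseteq> (\<Union>y\<in>F. cball y (r / 2 ^ k))" by blast
  have "\<forall>y::'a. \<exists>G. finite G \<and> cball y (2 * (r / 2 ^ Suc k)) \<subseteq> (\<Union>z\<in>G. cball z (r / 2 ^ Suc k))"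
    using assms unfolding finitely_doubling_def by (meson divide_pos_pos zero_less_numeral zero_less_power)
  then obtain G where G: "\<And>y::'a. finite (G y)"
    "\<And>y. cball y (2 * (r / 2 ^ Suc k)) \<subseteq> (\<Union>z\<in>G y. cball z (r / 2 ^ Suc k))"
    by metis
  have "2 * (r / 2 ^ Suc k) = r / 2 ^ k" by simp
  with F G(2) have "cball x r \<subseteq> (\<Union>y\<in>(\<Union>y\<in>F. G y). cball y (r / 2 ^ Suc k))"
    by fastforce
  with F(1) G(1) show ?case by blast
qed

text \<open>Finite doubling enters the proof in the form of separability: the space is a countable
  union of balls around one point, each with finite covers at arbitrarily small radii, and the
  centres of all these covers form a countable dense set.\<close>

lemma finitely_doubling_dense_sequence:
  assumes "finitely_doubling TYPE('a::metric_space)"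
  obtains z :: "nat \<Rightarrow> 'a::metric_space" where "\<And>x e. e > 0 \<Longrightarrow> \<exists>j. dist x (z j) \<le> e"
proof -
  fix x0 :: 'a
  have "\<forall>m k. \<exists>F. finite F \<and> cball x0 (real (Suc m)) \<subseteq> (\<Union>y\<in>F. cball y (real (Suc m) / 2 ^ k))"
    using finitely_doubling_cover[OF assms] by (metis of_nat_0_less_iff zero_less_Suc)
  then obtain F where fin: "\<And>m k. finite (F m k)"
    and cover: "\<And>m k. cball x0 (real (Suc m)) \<subseteq> (\<Union>y\<in>F m k. cball y (real (Suc m) / 2 ^ k))"
    by metis
  define D where "D = insert x0 (\<Union>m k. F m k)"
  have "countable D" unfolding D_def using countable_finite[OF fin] by simp
  have dense: "\<exists>y\<in>D. dist x y \<le> e" if "e > 0" for x e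
  proof -
    obtain m :: nat where "dist x0 x \<le> m" using real_arch_simple by blast
    then have x: "x \<in> cball x0 (real (Suc m))" by simp
    obtain k where "(1/2) ^ k < e / real (Suc m)"
      using real_arch_pow_inv[of "e / real (Suc m)" "1/2"] \<open>e > 0\<close> by auto
    then have k: "real (Suc m) / 2 ^ k \<le> e" by (simp add: field_simps)
    from x cover obtain y where "y \<in> F m k" "x \<in> cball y (real (Suc m) / 2 ^ k)" by blast
    with k show ?thesis unfolding D_def by (force simp: dist_commute)
  qed
  have "D \<noteq> {}" by (simp add: D_def)
  with \<open>countable D\<close> have "range (from_nat_into D) = D" by (rule range_from_nat_into[rotated])
  with dense show ?thesis by (intro that[of "from_nat_into D"]) (metis rangeE)
qed

section \<open>Cantor measures\<close>

lemma limit_of_geometric_steps: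
  fixes X :: "nat \<Rightarrow> 'a::complete_space"
  assumes step: "\<And>k. dist (X k) (X (Suc k)) \<le> s * \<theta> ^ k" and "0 \<le> \<theta>" "\<theta> \<le> 1 / 2" "0 \<le> s"
  shows "convergent X" "dist (X k) (lim X) \<le> 2 * s * \<theta> ^ k"
proof -
  have far: "dist (X k) (X (k + m)) \<le> 2 * s * \<theta> ^ k" for k m
  proof -
    \<comment> \<open>The subtracted term makes the induction close: as \<theta> is at most 1/2, its
      decrease from m to m + 1 is at least \<open>s * \<theta> ^ (k + m)\<close>, the length of the
      new step.\<close>
    have "dist (X k) (X (k + m)) \<le> 2 * s * \<theta> ^ k - 2 * s * \<theta> ^ (k + m)"
    proof (induction m)
      case (Suc m)
      have "2 * (s * \<theta> ^ (k + m)) * \<theta> \<le> 2 * (s * \<theta> ^ (k + m)) * (1 / 2)"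
        using assms by (intro mult_left_mono) auto
      moreover have "dist (X k) (X (k + Suc m)) \<le> dist (X k) (X (k + m)) + dist (X (k + m)) (X (k + Suc m))"
        by (rule dist_triangle)
      ultimately show ?case using Suc step[of "k + m"] by (simp add: algebra_simps)
    qed simp
    moreover have "2 * s * \<theta> ^ (k + m) \<ge> 0" using assms by simp
    ultimately show ?thesis by linarith
  qed
  have "Cauchy X"
    unfolding Cauchy_altdef2
  proof (intro allI impI)
    fix e :: real assume "e > 0"
    have "(\<lambda>k. 2 * s * \<theta> ^ k) \<longlonglongrightarrow> 2 * s * 0"
      using assms by (intro tendsto_intros LIMSEQ_realpow_zero) auto
    then have "eventually (\<lambda>k. 2 * s * \<theta> ^ k < e) sequentially"
      using \<open>e > 0\<close> by (intro order_tendstoD) auto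
    then obtain N where N: "2 * s * \<theta> ^ N < e" by (auto simp: eventually_sequentially)
    have "dist (X n) (X N) < e" if "n \<ge> N" for n
      using far[of N "n - N"] N that by (simp add: dist_commute)
    then show "\<exists>N. \<forall>n\<ge>N. dist (X n) (X N) < e" by blast
  qed
  then show "convergent X" by (simp add: Cauchy_convergent)
  then have "X \<longlonglongrightarrow> lim X" by (simp add: convergent_LIMSEQ_iff)
  then have "(\<lambda>m. dist (X k) (X (m + k))) \<longlonglongrightarrow> dist (X k) (lim X)"
    by (intro tendsto_intros LIMSEQ_ignore_initial_segment)
  then show "dist (X k) (lim X) \<le> 2 * s * \<theta> ^ k"
    by (rule LIMSEQ_le_const2) (use far[of k] in \<open>simp add: add.commute\<close>)
qed

section \<open>Binary trees of points and dyadic intervals\<close>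

text \<open>In the application \<open>w p r\<close> is a point at distance between r / C and r from
  p. Since even positions repeat the parent, the leftmost branch stays at z, which is why the
  resulting measure charges every ball around z.\<close>

primrec dyadic_point :: "('a \<Rightarrow> real \<Rightarrow> 'a) \<Rightarrow> (nat \<Rightarrow> real) \<Rightarrow> 'a \<Rightarrow> nat \<Rightarrow> nat \<Rightarrow> 'a" where
  "dyadic_point w \<sigma> z 0 i = z"
| "dyadic_point w \<sigma> z (Suc k) i =
     (let p = dyadic_point w \<sigma> z k (i div 2) in if even i then p else w p (\<sigma> k))"

definition dyadic_index :: "nat \<Rightarrow> real \<Rightarrow> nat" where
  "dyadic_index k t = nat \<lfloor>2 ^ k * t\<rfloor>"

text \<open>For t in [0,1) the index is the number formed by the first k binary digits of t, and
  \<open>div 2\<close> drops the last one, so consecutive levels are child and parent. As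
  \<open>nat\<close> sends negative values to 0, this holds for every real t, and each t defines a
  branch of the tree.\<close>

lemma dyadic_index_Suc_div: "dyadic_index (Suc k) t div 2 = dyadic_index k t"
proof -
  have "\<lfloor>2 * u\<rfloor> div 2 = \<lfloor>u\<rfloor>" for u :: real by linarith
  then have "\<lfloor>2 ^ Suc k * t\<rfloor> div 2 = \<lfloor>2 ^ k * t\<rfloor>"
    by (metis mult.assoc power_Suc)
  then show ?thesis
    unfolding dyadic_index_def by (metis nat_div_distrib' nat_numeral zero_le_numeral)
qed

lemma dyadic_index_less:
  assumes "t \<in> {0..<1}"
  shows "dyadic_index k t < 2 ^ k"
proof -
  have "\<lfloor>2 ^ k * t\<rfloor> < (2::int) ^ k" using assms by (simp add: floor_less_iff)
  then have "nat \<lfloor>2 ^ k * t\<rfloor> < nat (2 ^ k)" by (subst nat_mono_iff) auto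
  then show ?thesis by (simp add: dyadic_index_def nat_power_eq)
qed

lemma dyadic_interval:
  assumes "i < 2 ^ k"
  shows "{t \<in> {0..<1}. dyadic_index k t = i} = {real i / 2 ^ k..<(real i + 1) / 2 ^ k}"
proof -
  have "real (Suc i) \<le> real (2 ^ k)" using assms by (subst of_nat_le_iff) simp
  then have le1: "(real i + 1) / 2 ^ k \<le> 1" by (simp add: add.commute)
  show ?thesis
  proof (intro set_eqI iffI)
    fix t assume "t \<in> {t \<in> {0..<1}. dyadic_index k t = i}"
    then have t: "0 \<le> t" "int i = \<lfloor>2 ^ k * t\<rfloor>" by (auto simp: dyadic_index_def)
    then have "real i \<le> 2 ^ k * t" "2 ^ k * t < real i + 1" by linarith+
    then show "t \<in> {real i / 2 ^ k..<(real i + 1) / 2 ^ k}" by (simp add: field_simps)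
  next
    fix t assume t: "t \<in> {real i / 2 ^ k..<(real i + 1) / 2 ^ k}"
    then have "real i \<le> 2 ^ k * t" "2 ^ k * t < real i + 1" by (auto simp: field_simps)
    then have "\<lfloor>2 ^ k * t\<rfloor> = int i" by linarith
    moreover have "0 \<le> t" using t order_trans[of 0 "real i / 2 ^ k" t] by simp
    moreover have "t < 1" using t le1 less_le_trans[of t "(real i + 1) / 2 ^ k" 1] by simp
    ultimately show "t \<in> {t \<in> {0..<1}. dyadic_index k t = i}" by (simp add: dyadic_index_def)
  qed
qed

lemma emeasure_dyadic_interval:
  assumes "i < 2 ^ k"
  shows "emeasure lborel {t \<in> {0..<1}. dyadic_index k t = i} = ennreal (1 / 2 ^ k)"
  unfolding dyadic_interval[OF assms] by (simp add: divide_right_mono diff_divide_distrib[symmetric])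

lemma measurable_dyadic_index [measurable]: "dyadic_index k \<in> borel \<rightarrow>\<^sub>M count_space UNIV"
  unfolding dyadic_index_def[abs_def] by measurable

text \<open>A ball of radius r is compared with the tree at the level k where \<sigma> drops to 4 C
  r or below between k and k + 1. Below each node of level k the ball meets at most one child, hence
  at most half of the node's mass. Limits below one node are at most 4 \<sigma>(k) apart, which is
  at most 128 C^2 r, so the enlarged ball contains all limits below each node that the ball
  meets.\<close>

lemma cantor_measure:
  fixes z :: "'a::complete_space" and C s :: real
  assumes C: "C \<ge> 1" and s: "s > 0"
    and perfect: "\<And>(p::'a) r. 0 < r \<Longrightarrow> r \<le> s \<Longrightarrow> \<exists>q. r / C < dist p q \<and> dist p q \<le> r"
  obtains M :: "'a measure" where "sets M = sets borel"
    "emeasure M UNIV = 1" "emeasure M (cball z (2 * s)) = 1"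
    "\<And>e. e > 0 \<Longrightarrow> emeasure M (cball z e) > 0"
    "\<And>x r. 0 < r \<Longrightarrow> r < s / (4 * C) \<Longrightarrow>
       2 * emeasure M (cball x r) \<le> emeasure M (cball x ((1 + 128 * C\<^sup>2) * r))"
proof -
  obtain w where w: "\<And>(p::'a) r. 0 < r \<Longrightarrow> r \<le> s \<Longrightarrow> r / C < dist p (w p r) \<and> dist p (w p r) \<le> r"
  proof
    show "r / C < dist p (SOME q. r / C < dist p q \<and> dist p q \<le> r) \<and>
        dist p (SOME q. r / C < dist p q \<and> dist p q \<le> r) \<le> r" if "0 < r" "r \<le> s" for p :: 'a and r
      using someI_ex[OF perfect[OF that]] .
  qed
  \<comment> \<open>With ratio 8 C, siblings created at step k are more than \<sigma>(k) / C = 8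
    \<sigma>(k+1) apart. Each moves by at most 2 \<sigma>(k+1) in the limit, so at least half of the
    gap remains.\<close>
  define \<sigma> where "\<sigma> k = s * (1 / (8 * C)) ^ k" for k
  have \<sigma>: "\<sigma> k > 0" "\<sigma> k \<le> s" "\<sigma> k = 8 * C * \<sigma> (Suc k)" for k
    using C s by (auto simp: \<sigma>_def mult_le_cancel_left1 power_le_one)
  have \<sigma>_lim: "\<sigma> \<longlonglongrightarrow> 0"
  proof -
    have "(\<lambda>k. s * (1 / (8 * C)) ^ k) \<longlonglongrightarrow> s * 0"
      using C by (intro tendsto_intros LIMSEQ_realpow_zero) auto
    then show ?thesis by (simp add: \<sigma>_def[abs_def])
  qed
  define P where "P = dyadic_point w \<sigma> z"
  define X where "X t k = P k (dyadic_index k t)" for t k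
  define f where "f t = lim (X t)" for t
  have step: "dist (X t k) (X t (Suc k)) \<le> \<sigma> k" for t k
    using w[of "\<sigma> k" "X t k"] \<sigma>[of k] by (simp add: X_def P_def dyadic_index_Suc_div Let_def)
  have conv: "convergent (X t)" and near: "dist (X t k) (f t) \<le> 2 * \<sigma> k" for t k
    using limit_of_geometric_steps[where X = "X t" and s = s and \<theta> = "1 / (8 * C)"] step[of t] C s
    by (auto simp: \<sigma>_def f_def mult.assoc)
  have f_meas: "f \<in> borel_measurable borel"
  proof (rule borel_measurable_LIMSEQ_metric)
    \<comment> \<open>At a fixed level the approximation factors through a discrete space, where
      every map is measurable.\<close>
    show "(\<lambda>t. X t k) \<in> borel_measurable borel" for k
      unfolding X_def by (rule measurable_compose[OF measurable_dyadic_index]) simp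
    show "(\<lambda>k. X t k) \<longlonglongrightarrow> f t" for t
      using conv[of t] by (simp add: f_def convergent_LIMSEQ_iff)
  qed
  define M where "M = distr (restrict_space lborel {0..<1}) borel f"
  have eM: "emeasure M A = emeasure lborel {t \<in> {0..<1}. f t \<in> A}" if "A \<in> sets borel" for A
  proof -
    have "emeasure M A = emeasure (restrict_space lborel {0..<1}) (f -` A \<inter> {0..<1})"
      unfolding M_def using that f_meas
      by (subst emeasure_distr) (auto simp: space_restrict_space intro!: measurable_restrict_space1)
    also have "\<dots> = emeasure lborel (f -` A \<inter> {0..<1})"
      by (rule emeasure_restrict_space) auto
    also have "f -` A \<inter> {0..<1} = {t \<in> {0..<1}. f t \<in> A}" by blast
    finally show ?thesis .
  qed
  have eM_cball: "emeasure M (cball x r) = emeasure lborel {t \<in> {0..<1}. f t \<in> cball x r}" for x r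
    by (rule eM) simp
  define I where "I k i = {t \<in> {0..<1}. dyadic_index k t = i}" for k i
  have I_sets: "I k i \<in> sets lborel" for k i
    unfolding I_def by measurable
  have cball_sets: "{t \<in> {0..<1}. f t \<in> cball x r} \<in> sets lborel" for x r
  proof -
    have "f -` cball x r \<in> sets borel"
      using measurable_sets[OF f_meas, of "cball x r"] by simp
    then have "{0..<1} \<inter> f -` cball x r \<in> sets borel" by (rule sets.Int[rotated]) simp
    also have "{0..<1} \<inter> f -` cball x r = {t \<in> {0..<1}. f t \<in> cball x r}" by blast
    finally show ?thesis by simp
  qed
  show thesis
  proof
    show "sets M = sets borel" by (simp add: M_def)
    have "{t \<in> {0..<1}. f t \<in> UNIV} = {0..<1}" by blast
    then show "emeasure M UNIV = 1" using eM[of UNIV] by (simp del: atLeastLessThan_iff)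
    have "{t \<in> {0..<1}. f t \<in> cball z (2 * s)} = {0..<1}"
      using near[of _ 0] by (auto simp: X_def P_def \<sigma>_def)
    then show "emeasure M (cball z (2 * s)) = 1" unfolding eM_cball by simp
    show "emeasure M (cball z e) > 0" if "e > 0" for e
    proof -
      have "eventually (\<lambda>k. \<sigma> k < e / 2) sequentially"
        using \<open>e > 0\<close> by (intro order_tendstoD(2)[OF \<sigma>_lim]) simp
      then obtain k where k: "\<sigma> k < e / 2" by (auto simp: eventually_sequentially)
      have P0: "P k 0 = z" by (induction k) (auto simp: P_def)
      have "dist z (f t) \<le> e" if "t \<in> I k 0" for t
        using near[of t k] k P0 that by (simp add: I_def X_def)
      then have "I k 0 \<subseteq> {t \<in> {0..<1}. f t \<in> cball z e}" by (auto simp: I_def)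
      then have "emeasure lborel (I k 0) \<le> emeasure M (cball z e)"
        unfolding eM_cball by (intro emeasure_mono cball_sets)
      moreover have "emeasure lborel (I k 0) > 0"
        unfolding I_def by (subst emeasure_dyadic_interval) auto
      ultimately show ?thesis by order
    qed
    show "2 * emeasure M (cball x r) \<le> emeasure M (cball x ((1 + 128 * C\<^sup>2) * r))"
      if r: "0 < r" "r < s / (4 * C)" for x r
    proof -
      \<comment> \<open>The first level with \<sigma> at most 4 C r exists because \<sigma> tends to
        0. It is not level 0, by the bound on r, so it has a predecessor k.\<close>
      have "eventually (\<lambda>k. \<sigma> k < 4 * C * r) sequentially"
        using r C by (intro order_tendstoD(2)[OF \<sigma>_lim]) simp
      then obtain k0 where "\<sigma> k0 \<le> 4 * C * r"
        by (auto simp: eventually_sequentially intro: less_imp_le)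
      moreover have "\<not> \<sigma> 0 \<le> 4 * C * r"
        using r C by (simp add: \<sigma>_def field_simps)
      ultimately obtain k where k: "\<sigma> (Suc k) \<le> 4 * C * r" "4 * C * r < \<sigma> k"
        using ex_least_nat_less[of "\<lambda>k. \<sigma> k \<le> 4 * C * r" k0] by force
      let ?S = "{t \<in> {0..<1}. f t \<in> cball x r}"
      let ?T = "{t \<in> {0..<1}. f t \<in> cball x ((1 + 128 * C\<^sup>2) * r)}"
      have part: "emeasure lborel A = (\<Sum>i<2 ^ k. emeasure lborel (A \<inter> I k i))"
        if "A \<in> sets lborel" "A \<subseteq> {0..<1}" for A
      proof -
        have "A = (\<Union>i<2 ^ k. A \<inter> I k i)"
          using that(2) dyadic_index_less[of _ k] by (fastforce simp: I_def)
        then have "emeasure lborel A = emeasure lborel (\<Union>i<2 ^ k. A \<inter> I k i)" by simp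
        also have "\<dots> = (\<Sum>i<2 ^ k. emeasure lborel (A \<inter> I k i))"
          using that(1) I_sets[of k]
          by (intro sum_emeasure[symmetric]) (auto simp: disjoint_family_on_def I_def)
        finally show ?thesis .
      qed
      have half: "2 * emeasure lborel (?S \<inter> I k i) \<le> emeasure lborel (?T \<inter> I k i)" if i: "i < 2 ^ k" for i
      proof (cases "?S \<inter> I k i = {}")
        case False
        then obtain t where t: "t \<in> ?S" "t \<in> I k i" by blast
        let ?j = "dyadic_index (Suc k) t"
        have "t' \<in> ?T" if t': "t' \<in> I k i" for t'
        proof -
          have eq: "X t k = X t' k" using t(2) t' by (simp add: X_def I_def)
          have "\<sigma> k \<le> 8 * C * (4 * C * r)" using \<sigma>(3)[of k] k(1) C by simp
          then have "4 * \<sigma> k \<le> 128 * C\<^sup>2 * r" by (simp add: power2_eq_square)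
          moreover have "dist x (f t') \<le> dist x (f t) + (dist (X t k) (f t) + dist (X t' k) (f t'))"
            unfolding eq by metric
          ultimately have "dist x (f t') \<le> (1 + 128 * C\<^sup>2) * r"
            using t(1) near[of t k] near[of t' k] by (simp add: algebra_simps)
          then show ?thesis using t' by (simp add: I_def)
        qed
        then have T: "?T \<inter> I k i = I k i" by blast
        have "t' \<in> I (Suc k) ?j" if t': "t' \<in> ?S" "t' \<in> I k i" for t'
        proof (rule ccontr)
          assume "t' \<notin> I (Suc k) ?j"
          \<comment> \<open>Different indices with the same parent i have different parity, so one
            branch continues at \<open>?p\<close> and the other at \<open>w ?p (\<sigma> k)\<close>.
            Two limits in a ball of radius r are too close for that.\<close>
          then have ne: "dyadic_index (Suc k) t' \<noteq> ?j" using t' by (simp add: I_def)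
          have ii: "dyadic_index k t' = i" "dyadic_index k t = i" using t' t by (auto simp: I_def)
          have div2: "dyadic_index (Suc k) t' div 2 = i" "?j div 2 = i"
            using ii by (simp_all add: dyadic_index_Suc_div)
          then have par: "even (dyadic_index (Suc k) t') \<noteq> even ?j"
            using ne by (metis bit_eq_rec)
          let ?p = "P k i"
          have "{X t (Suc k), X t' (Suc k)} = {?p, w ?p (\<sigma> k)}"
            using par div2 by (auto simp: X_def P_def Let_def)
          then have "dist (X t (Suc k)) (X t' (Suc k)) = dist ?p (w ?p (\<sigma> k))"
            by (auto simp: doubleton_eq_iff dist_commute)
          then have "\<sigma> k / C < dist (X t (Suc k)) (X t' (Suc k))"
            using w[of "\<sigma> k" ?p] \<sigma>(1,2)[of k] by simp
          also have "\<dots> \<le> dist (X t (Suc k)) (f t) + dist (X t' (Suc k)) (f t') + (dist x (f t) + dist x (f t'))"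
            by metric
          also have "\<dots> \<le> 4 * \<sigma> (Suc k) + 2 * r"
            using near[of t "Suc k"] near[of t' "Suc k"] t(1) t'(1) by simp
          \<comment> \<open>Here 4 \<sigma>(k+1) is exactly half of \<sigma>(k) / C, and 2 r is
            below the other half since 4 C r < \<sigma>(k).\<close>
          also have "\<dots> \<le> \<sigma> k / C"
            using k(2) \<sigma>(3)[of k] C by (simp add: field_simps)
          finally show False by simp
        qed
        then have "?S \<inter> I k i \<subseteq> I (Suc k) ?j" by blast
        then have "emeasure lborel (?S \<inter> I k i) \<le> emeasure lborel (I (Suc k) ?j)"
          by (intro emeasure_mono I_sets)
        also have "\<dots> = ennreal (1 / 2 ^ Suc k)"
          unfolding I_def using t by (intro emeasure_dyadic_interval dyadic_index_less) auto
        finally have "2 * emeasure lborel (?S \<inter> I k i) \<le> 2 * ennreal (1 / 2 ^ Suc k)"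
          by (intro mult_left_mono) auto
        also have "\<dots> = ennreal (1 / 2 ^ k)"
          by (subst ennreal_numeral[symmetric], subst ennreal_mult[symmetric]) auto
        also have "\<dots> = emeasure lborel (?T \<inter> I k i)"
          unfolding T using emeasure_dyadic_interval[OF i] by (simp add: I_def)
        finally show ?thesis .
      qed simp
      have "2 * emeasure lborel ?S = (\<Sum>i<2 ^ k. 2 * emeasure lborel (?S \<inter> I k i))"
        by (subst part[OF cball_sets]) (auto simp: sum_distrib_left)
      also have "\<dots> \<le> (\<Sum>i<2 ^ k. emeasure lborel (?T \<inter> I k i))"
        by (intro sum_mono half) simp
      also have "\<dots> = emeasure lborel ?T"
        by (intro part[symmetric] cball_sets) auto
      finally show ?thesis unfolding eM_cball .
    qed
  qed
qed

section \<open>Reverse-doubling measures charging a given point\<close>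

text \<open>If a ball of radius at most D / 3 were the whole space, all distances would be at most 2
  D / 3. Hence uniform perfectness is available at all radii up to D / 3.\<close>

lemma diameter_dichotomy:
  fixes x0 y0 :: "'a::metric_space"
  assumes "x0 \<noteq> y0" "bounded (UNIV :: 'a set)"
  defines "D \<equiv> diameter (UNIV :: 'a set)"
  shows "D > 0" "ediam TYPE('a) \<le> ennreal D" "\<And>(p::'a) r. r \<le> D / 3 \<Longrightarrow> UNIV - cball p r \<noteq> {}"
proof -
  have dist_le: "dist x y \<le> D" for x y :: 'a
    unfolding D_def by (rule diameter_bounded_bound[OF assms(2)]) auto
  have D_le: "D \<le> d" if "\<And>x y :: 'a. dist x y \<le> d" for d
    unfolding D_def diameter_def using that by (auto intro!: cSUP_least)
  have "0 < dist x0 y0" using assms(1) by simp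
  also note dist_le
  finally show D: "D > 0" .
  show "ediam TYPE('a) \<le> ennreal D"
    unfolding ediam_def by (auto intro!: SUP_least ennreal_leI dist_le)
  show "UNIV - cball p r \<noteq> {}" if r: "r \<le> D / 3" for p :: 'a and r
  proof
    assume "UNIV - cball p r = {}"
    then have le: "dist p x \<le> r" for x by (metis DiffI UNIV_I empty_iff mem_cball)
    have "dist x y \<le> 2 * D / 3" for x y :: 'a
      using dist_triangle3[of x y p] le[of x] le[of y] r by linarith
    then have "D \<le> 2 * D / 3" by (rule D_le)
    with D show False by simp
  qed
qed

text \<open>The index N belongs to both ranges: its a-term is at most 2^N / 2. So the a-terms up to
  N sum to at most (2^N - 1) + 2^N / 2, the b-terms to 2^(N+1) - 1, and the factor 4/3 fits in
  between. Beyond N the terms compare with factor 2.\<close>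

lemma weighted_sum_reverse_doubling:
  fixes a b :: "nat \<Rightarrow> ennreal"
  assumes tail: "\<And>n. n \<ge> N \<Longrightarrow> 2 * a n \<le> b n"
    and head: "\<And>n. n \<le> N \<Longrightarrow> a n \<le> ennreal (2 ^ n)" "\<And>n. n \<le> N \<Longrightarrow> b n = ennreal (2 ^ n)"
  shows "ennreal (4 / 3) * (\<Sum>n. a n) \<le> (\<Sum>n. b n)"
proof -
  have "a N < \<infinity>" using head(1)[of N] by (simp add: order_le_less_trans)
  then obtain m where m: "m \<ge> 0" "a N = ennreal m"
    by (metis ennreal_cases infinity_ennreal_def less_irrefl)
  have "ennreal (2 * m) = 2 * a N" using m by (simp add: ennreal_mult)
  also have "\<dots> \<le> ennreal (2 ^ N)" using tail[of N] head(2)[of N] by simp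
  finally have m_le: "2 * m \<le> 2 ^ N" by (simp add: m)
  have geo: "(\<Sum>n<K. ennreal (2 ^ n)) = ennreal (2 ^ K - 1)" for K
    by (subst sum_ennreal) (auto simp: geometric_sum)
  have "(\<Sum>n<Suc N. a n) \<le> (\<Sum>n<N. ennreal (2 ^ n)) + a N"
    unfolding sum.lessThan_Suc by (intro add_right_mono sum_mono head(1)) simp
  also have "\<dots> = ennreal ((2 ^ N - 1) + m)"
    unfolding geo m(2) using m(1) by (subst ennreal_plus) auto
  finally have "ennreal (4 / 3) * (\<Sum>n<Suc N. a n) \<le> ennreal (4 / 3) * ennreal ((2 ^ N - 1) + m)"
    by (rule mult_left_mono) simp
  also have "\<dots> = ennreal (4 / 3 * ((2 ^ N - 1) + m))" using m(1) by (subst ennreal_mult) auto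
  also have "\<dots> \<le> ennreal (2 ^ Suc N - 1)"
    using m_le by (intro ennreal_leI) simp
  also have "\<dots> = (\<Sum>n<Suc N. b n)" unfolding geo[symmetric] using head(2) by (intro sum.cong) auto
  finally have 1: "ennreal (4 / 3) * (\<Sum>n<Suc N. a n) \<le> (\<Sum>n<Suc N. b n)" .
  have "ennreal (4 / 3) * a (n + Suc N) \<le> b (n + Suc N)" for n
  proof -
    have "ennreal (4 / 3) \<le> ennreal 2" by (intro ennreal_leI) simp
    then have "ennreal (4 / 3) * a (n + Suc N) \<le> 2 * a (n + Suc N)" by (intro mult_right_mono) auto
    also have "\<dots> \<le> b (n + Suc N)" by (rule tail) simp
    finally show ?thesis .
  qed
  then have "(\<Sum>n. ennreal (4 / 3) * a (n + Suc N)) \<le> (\<Sum>n. b (n + Suc N))"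
    by (intro suminf_le) auto
  then have 2: "ennreal (4 / 3) * (\<Sum>n. a (n + Suc N)) \<le> (\<Sum>n. b (n + Suc N))" by simp
  have "(\<Sum>n. a n) = (\<Sum>n. a (n + Suc N)) + (\<Sum>n<Suc N. a n)"
    and "(\<Sum>n. b n) = (\<Sum>n. b (n + Suc N)) + (\<Sum>n<Suc N. b n)"
    by (rule suminf_offset; simp)+
  with add_mono[OF 2 1] show ?thesis by (simp only: distrib_left)
qed

lemma reverse_doubling_measure_at_bounded:
  fixes z :: "'a::complete_space" and C :: real
  assumes two: "\<exists>x y :: 'a. x \<noteq> y" and bdd: "bounded (UNIV :: 'a set)" and C: "C \<ge> 1"
    and perfect: "\<And>(x::'a) r. r > 0 \<Longrightarrow> UNIV - cball x r \<noteq> {} \<Longrightarrow> cball x r - cball x (r / C) \<noteq> {}"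
  defines "\<tau> \<equiv> 1 + 128 * C\<^sup>2"
  obtains M :: "'a measure" where "sets M = sets borel" "\<And>x R. emeasure M (cball x R) < \<infinity>"
    "\<And>e. e > 0 \<Longrightarrow> emeasure M (cball z e) > 0"
    "\<And>x r. 0 < r \<Longrightarrow> ennreal r \<le> ediam TYPE('a) / ennreal (2 * \<tau>) \<Longrightarrow>
       ennreal (4 / 3) * emeasure M (cball x r) \<le> emeasure M (cball x (\<tau> * r))"
proof -
  define D where "D = diameter (UNIV :: 'a set)"
  obtain x0 y0 :: 'a where "x0 \<noteq> y0" using two by blast
  note D = diameter_dichotomy[OF this bdd, folded D_def]
  have "\<exists>q. r / C < dist p q \<and> dist p q \<le> r" if "0 < r" "r \<le> D / 3" for p :: 'a and r
    using perfect[OF that(1) D(3)[OF that(2), of p]] by (auto simp: not_le)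
  moreover have "D / 3 > 0" using D(1) by simp
  ultimately obtain M :: "'a measure" where M: "sets M = sets borel" "emeasure M UNIV = 1"
    "\<And>e. e > 0 \<Longrightarrow> emeasure M (cball z e) > 0"
    "\<And>x r. 0 < r \<Longrightarrow> r < D / 3 / (4 * C) \<Longrightarrow> 2 * emeasure M (cball x r) \<le> emeasure M (cball x (\<tau> * r))"
    using cantor_measure[OF C, of "D / 3" z] unfolding \<tau>_def by metis
  show thesis
  proof
    show "emeasure M (cball x R) < \<infinity>" for x R
    proof -
      have "emeasure M (cball x R) \<le> emeasure M UNIV" by (intro emeasure_mono) (auto simp: M(1))
      then show ?thesis by (simp add: M(2) order_le_less_trans)
    qed
    show "ennreal (4 / 3) * emeasure M (cball x r) \<le> emeasure M (cball x (\<tau> * r))"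
      if r: "0 < r" "ennreal r \<le> ediam TYPE('a) / ennreal (2 * \<tau>)" for x r
    proof -
      have "C \<le> C\<^sup>2" using C by (simp add: self_le_power)
      \<comment> \<open>This puts every admissible radius below (D / 3) / (4 C), the range of the
        Cantor estimate at scale D / 3.\<close>
      then have \<tau>: "12 * C < 2 * \<tau>" unfolding \<tau>_def using C by argo
      then have "0 < \<tau>" using C by linarith
      note \<tau> = \<tau> this
      note r(2)
      also have "ediam TYPE('a) / ennreal (2 * \<tau>) \<le> ennreal D / ennreal (2 * \<tau>)"
        by (intro divide_right_mono_ennreal D(2))
      also have "\<dots> = ennreal (D / (2 * \<tau>))" using D(1) \<tau> by (simp add: divide_ennreal)
      finally have "r \<le> D / (2 * \<tau>)" using D(1) \<tau> by (subst (asm) ennreal_le_iff) auto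
      also have "\<dots> < D / (12 * C)" using \<tau> D(1) C by (intro divide_strict_left_mono) auto
      finally have "r < D / 3 / (4 * C)" by simp
      from M(4)[OF r(1) this]
      have "2 * emeasure M (cball x r) \<le> emeasure M (cball x (\<tau> * r))" .
      moreover have "ennreal (4 / 3) * emeasure M (cball x r) \<le> ennreal 2 * emeasure M (cball x r)"
        by (intro mult_right_mono ennreal_leI) auto
      ultimately show ?thesis by simp
    qed
  qed (use M in auto)
qed

lemma reverse_doubling_measure_at_unbounded:
  fixes z :: "'a::complete_space" and C :: real
  assumes unb: "\<not> bounded (UNIV :: 'a set)" and C: "C \<ge> 1"
    and perfect: "\<And>(x::'a) r. r > 0 \<Longrightarrow> UNIV - cball x r \<noteq> {} \<Longrightarrow> cball x r - cball x (r / C) \<noteq> {}"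
  defines "\<tau> \<equiv> 1 + 128 * C\<^sup>2"
  obtains M :: "'a measure" where "sets M = sets borel" "\<And>x R. emeasure M (cball x R) < \<infinity>"
    "\<And>e. e > 0 \<Longrightarrow> emeasure M (cball z e) > 0"
    "\<And>x r. 0 < r \<Longrightarrow> ennreal (4 / 3) * emeasure M (cball x r) \<le> emeasure M (cball x (\<tau> * r))"
proof -
  have far: "\<exists>q. r / C < dist p q \<and> dist p q \<le> r" if "0 < r" for p :: 'a and r
  proof -
    have "UNIV - cball p r \<noteq> {}" using unb bounded_subset[OF bounded_cball, of UNIV p r] by blast
    from perfect[OF that this] show ?thesis by (auto simp: not_le)
  qed
  \<comment> \<open>The term n = 0 sits at z itself, to charge the balls around z.\<close>
  have "\<exists>q. (n = 0 \<longrightarrow> q = z) \<and> (n > 0 \<longrightarrow> 2 ^ n / C < dist z q) \<and> dist z q \<le> 2 ^ n" for n :: nat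
    using far[of "2 ^ n" z] by (cases "n = 0") auto
  then obtain y where y: "y 0 = z" "\<And>n. n > 0 \<Longrightarrow> 2 ^ n / C < dist z (y n)" "\<And>n. dist z (y n) \<le> 2 ^ n"
    by metis
  \<comment> \<open>The n-th measure lives in a ball of radius 2 s(n) = 2^n / (2 C) around y(n). For
    n > 0 this ball stays farther than 2^n / (2 C) from z, so a bounded set meets only finitely many
    of them.\<close>
  define s where "s n = 2 ^ n / (4 * C)" for n :: nat
  have s: "s n > 0" for n using C by (simp add: s_def)
  have "\<exists>M. sets M = sets borel \<and> emeasure M UNIV = 1 \<and> emeasure M (cball (y n) (2 * s n)) = 1 \<and>
    (\<forall>e>0. emeasure M (cball (y n) e) > 0) \<and>
    (\<forall>x r. 0 < r \<longrightarrow> r < s n / (4 * C) \<longrightarrow> 2 * emeasure M (cball x r) \<le> emeasure M (cball x (\<tau> * r)))" for n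
    by (rule cantor_measure[OF C s[of n], of "y n"], erule far) (unfold \<tau>_def, blast)
  then obtain K where K: "\<And>n. sets (K n) = sets borel" "\<And>n. emeasure (K n) UNIV = 1"
    "\<And>n. emeasure (K n) (cball (y n) (2 * s n)) = 1" "\<And>n e. e > 0 \<Longrightarrow> emeasure (K n) (cball (y n) e) > 0"
    "\<And>n x r. 0 < r \<Longrightarrow> r < s n / (4 * C) \<Longrightarrow> 2 * emeasure (K n) (cball x r) \<le> emeasure (K n) (cball x (\<tau> * r))"
    by metis
  have K_le1: "emeasure (K n) A \<le> 1" for n A
    using emeasure_space[of "K n" A] sets_eq_imp_space_eq[OF K(1)[of n]] K(2)[of n] by simp
  have K_one: "emeasure (K n) A = 1" if "A \<in> sets borel" "cball (y n) (2 * s n) \<subseteq> A" for n A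
    using emeasure_mono[OF that(2), of "K n"] that(1) K(1,3)[of n] K_le1[of n A] by simp
  have K_zero: "emeasure (K n) A = 0" if "A \<in> sets borel" "cball (y n) (2 * s n) \<inter> A = {}" for n A
  proof -
    have "cball (y n) (2 * s n) \<in> sets (K n)" "A \<in> sets (K n)" using that K(1)[of n] by auto
    then have "1 + emeasure (K n) A = emeasure (K n) (cball (y n) (2 * s n) \<union> A)"
      using plus_emeasure[of "cball (y n) (2 * s n)" "K n" A] that(2) K(3)[of n] by simp
    also have "\<dots> \<le> 1 + 0" using K_le1 by simp
    finally show ?thesis by (subst (asm) ennreal_add_left_cancel_le) auto
  qed
  obtain M :: "'a measure" where M: "sets M = sets borel"
    "\<And>A. A \<in> sets borel \<Longrightarrow> emeasure M A = (\<Sum>n. ennreal (2 ^ n) * emeasure (K n) A)"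
    using countable_sum_measure[of K borel "\<lambda>n. ennreal (2 ^ n)"] K(1) by metis
  have M_cball: "emeasure M (cball x r) = (\<Sum>n. ennreal (2 ^ n) * emeasure (K n) (cball x r))" for x r
    by (rule M) simp
  have s_le: "2 * s n \<le> 2 ^ n" "2 * s n = 2 ^ n / (2 * C)" for n
    using C by (auto simp: s_def field_simps)
  show thesis
  proof
    show "sets M = sets borel" by fact
    show "emeasure M (cball x R) < \<infinity>" for x R
    proof -
      obtain m where m: "2 * C * (dist z x + R) < 2 ^ m"
        using real_arch_pow[of 2 "2 * C * (dist z x + R)"] by auto
      \<comment> \<open>Starting at m + 1 guarantees n > 0, where the lower bound on the distance
        from z to y(n) holds.\<close>
      have zero: "emeasure (K n) (cball x R) = 0" if n: "n \<notin> {..<Suc m}" for n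
      proof (rule K_zero)
        have pos: "n > 0" using n by simp
        have "(2::real) ^ m \<le> 2 ^ n" using n by (intro power_increasing) auto
        with m have "2 * C * (dist z x + R) < 2 ^ n" by (rule less_le_trans)
        then have R: "dist z x + R < 2 ^ n / (2 * C)" using C by (simp add: field_simps)
        have sum: "2 ^ n / (2 * C) + 2 ^ n / (2 * C) = 2 ^ n / C" using C by (simp add: field_simps)
        show "cball (y n) (2 * s n) \<inter> cball x R = {}"
        proof (rule ccontr)
          assume "cball (y n) (2 * s n) \<inter> cball x R \<noteq> {}"
          then obtain p where "dist (y n) p \<le> 2 ^ n / (2 * C)" "dist x p \<le> R"
            unfolding s_le(2) by auto
          moreover have "dist z (y n) \<le> dist z x + dist x p + dist (y n) p" by metric
          ultimately show False using y(2)[OF pos] R sum by linarith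
        qed
      qed simp
      have "emeasure M (cball x R) = (\<Sum>n<Suc m. ennreal (2 ^ n) * emeasure (K n) (cball x R))"
        unfolding M_cball by (rule suminf_finite) (use zero in auto)
      also have "\<dots> \<le> (\<Sum>n<Suc m. ennreal (2 ^ n) * 1)"
        by (intro sum_mono mult_left_mono K_le1) auto
      also have "\<dots> < \<infinity>" by simp
      finally show ?thesis .
    qed
    show "emeasure M (cball z e) > 0" if "e > 0" for e
    proof -
      have "0 < ennreal (2 ^ 0) * emeasure (K 0) (cball z e)"
        using K(4)[OF that, of 0] y(1) by simp
      also have "\<dots> = (\<Sum>n\<in>{0}. ennreal (2 ^ n) * emeasure (K n) (cball z e))" by simp
      also have "\<dots> \<le> emeasure M (cball z e)"
        unfolding M_cball by (intro sum_le_suminf) auto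
      finally show ?thesis .
    qed
    show "ennreal (4 / 3) * emeasure M (cball x r) \<le> emeasure M (cball x (\<tau> * r))" if r: "0 < r" for x r
    proof -
      let ?a = "\<lambda>n. ennreal (2 ^ n) * emeasure (K n) (cball x r)"
      let ?b = "\<lambda>n. ennreal (2 ^ n) * emeasure (K n) (cball x (\<tau> * r))"
      have small: "2 * ?a n \<le> ?b n" if "r < s n / (4 * C)" for n
        using mult_left_mono[OF K(5)[OF r that, of x], of "ennreal (2 ^ n)"] by (simp add: mult.left_commute)
      have termwise: ?thesis if "\<And>n. 2 * ?a n \<le> ?b n"
      proof -
        have "ennreal (4 / 3) * emeasure M (cball x r) \<le> ennreal 2 * emeasure M (cball x r)"
          by (intro mult_right_mono ennreal_leI) auto
        also have "\<dots> = (\<Sum>n. 2 * ?a n)" unfolding M_cball ennreal_suminf_cmult by simp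
        also have "\<dots> \<le> emeasure M (cball x (\<tau> * r))"
          unfolding M_cball using that by (intro suminf_le) auto
        finally show ?thesis .
      qed
      obtain m where m: "16 * C\<^sup>2 * r < 2 ^ m"
        using real_arch_pow[of 2 "16 * C\<^sup>2 * r"] by auto
      \<comment> \<open>Since s(n) / (4 C) = 2^n / (16 C^2), the Cantor estimate at radius r covers
        exactly the terms n \<ge> N.\<close>
      define N where "N = (LEAST m. 16 * C\<^sup>2 * r < 2 ^ m)"
      have N: "16 * C\<^sup>2 * r < 2 ^ N" unfolding N_def using m by (rule LeastI)
      have tail: "2 * ?a n \<le> ?b n" if "n \<ge> N" for n
      proof (rule small)
        have "(2::real) ^ N \<le> 2 ^ n" using that by (intro power_increasing) auto
        with N have "16 * C\<^sup>2 * r < 2 ^ n" by (rule less_le_trans)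
        then show "r < s n / (4 * C)" using C by (simp add: s_def field_simps power2_eq_square)
      qed
      have supp: "cball (y n) (2 * s n) \<subseteq> cball z (2 * 2 ^ N)" if "n \<le> N" for n
      proof
        fix p assume "p \<in> cball (y n) (2 * s n)"
        then have "dist (y n) p \<le> 2 * s n" by simp
        moreover have "(2::real) ^ n \<le> 2 ^ N" using that by (intro power_increasing) auto
        moreover have "dist z p \<le> dist z (y n) + dist (y n) p" by (rule dist_triangle)
        ultimately have "dist z p \<le> 2 * 2 ^ N" using y(3)[of n] s_le(1)[of n] by linarith
        then show "p \<in> cball z (2 * 2 ^ N)" by simp
      qed
      show ?thesis
      \<comment> \<open>In the first case the terms below N are absent or give B(x, r) no mass, so
        factor 2 holds term by term. Otherwise minimality of N bounds 2^N by a multiple of r, and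
        the enlarged ball swallows B(z, 2 * 2^N) and with it the supports of all terms up to
        N.\<close>
      proof (cases "N = 0 \<or> cball z (2 * 2 ^ N) \<inter> cball x r = {}")
        case True
        have "2 * ?a n \<le> ?b n" for n
        proof (cases "n \<ge> N")
          case False
          with True have "cball z (2 * 2 ^ N) \<inter> cball x r = {}" by auto
          with supp[of n] False have "emeasure (K n) (cball x r) = 0"
            by (intro K_zero) auto
          then show ?thesis by simp
        qed (rule tail)
        then show ?thesis by (rule termwise)
      next
        case False
        then obtain N' where N': "N = Suc N'" by (cases N) auto
        have "\<not> 16 * C\<^sup>2 * r < 2 ^ N'"
          using not_less_Least[of N' "\<lambda>m. 16 * C\<^sup>2 * r < 2 ^ m"] N' unfolding N_def by simp
        then have big: "4 * 2 ^ N \<le> 128 * C\<^sup>2 * r" unfolding N' power_Suc not_less by linarith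
        obtain q where q: "dist z q \<le> 2 * 2 ^ N" "dist x q \<le> r" using False by auto
        have "cball z (2 * 2 ^ N) \<subseteq> cball x (\<tau> * r)"
        proof
          fix p assume "p \<in> cball z (2 * 2 ^ N)"
          moreover have "dist x p \<le> dist x q + dist z q + dist z p" by metric
          ultimately have "dist x p \<le> r + 4 * 2 ^ N" using q by simp
          also have "\<dots> \<le> \<tau> * r" using big by (simp add: \<tau>_def algebra_simps)
          finally show "p \<in> cball x (\<tau> * r)" by simp
        qed
        then have "?b n = ennreal (2 ^ n)" if "n \<le> N" for n
          using K_one[of "cball x (\<tau> * r)" n] supp[OF that] by auto
        moreover have "?a n \<le> ennreal (2 ^ n)" for n
          using mult_left_mono[OF K_le1, of "ennreal (2 ^ n)"] by simp
        ultimately show ?thesis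
          unfolding M_cball using tail by (intro weighted_sum_reverse_doubling[of N]) auto
      qed
    qed
  qed
qed

section \<open>The characterization\<close>

lemma uniformly_perfect_if_reverse_doubling:
  fixes \<mu> :: "'a::metric_space set \<Rightarrow> ennreal"
  assumes "metric_measure \<mu>" "fully_supported \<mu>" "reverse_doubling \<mu>"
  shows "uniformly_perfect TYPE('a)"
proof -
  obtain c \<tau> :: real where c: "c > 1" and \<tau>: "\<tau> > 1"
    and rd: "\<And>(x::'a) r. 0 < r \<Longrightarrow> ennreal r \<le> ediam TYPE('a) / ennreal (2 * \<tau>) \<Longrightarrow>
      \<mu> (cball x (\<tau> * r)) \<ge> ennreal c * \<mu> (cball x r)"
    using assms(3) unfolding reverse_doubling_def by auto
  have "cball x r - cball x (r / (2 * \<tau>)) \<noteq> {}" if r: "r > 0" "UNIV - cball x r \<noteq> {}" for x :: 'a and r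
  proof
    assume empty: "cball x r - cball x (r / (2 * \<tau>)) = {}"
    \<comment> \<open>A point outside B(x, r) makes the diameter exceed r, so this radius is
      admissible. Its \<tau>-fold is r / 2, and the empty annulus then bounds the mass of the larger
      ball by that of the smaller one, which is positive and finite.\<close>
    let ?r = "r / (2 * \<tau>)"
    have r0: "?r > 0" using r \<tau> by simp
    obtain y where "y \<notin> cball x r" using r(2) by blast
    then have y: "dist x y > r" by simp
    have "ennreal r \<le> ennreal (dist x y)" using y by (intro ennreal_leI) simp
    also have "\<dots> \<le> ediam TYPE('a)"
      unfolding ediam_def by (rule SUP_upper2[of "(x, y)"]) auto
    finally have "ennreal r / ennreal (2 * \<tau>) \<le> ediam TYPE('a) / ennreal (2 * \<tau>)"
      by (rule divide_right_mono_ennreal)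
    then have "ennreal ?r \<le> ediam TYPE('a) / ennreal (2 * \<tau>)"
      using r \<tau> by (simp add: divide_ennreal)
    note rd[OF r0 this, of x]
    also have "\<mu> (cball x (\<tau> * ?r)) \<le> \<mu> (cball x ?r)"
    proof -
      have "cball x (\<tau> * ?r) \<subseteq> cball x r" using r \<tau> by auto
      also have "\<dots> \<subseteq> cball x ?r" using empty by blast
      finally show ?thesis
        using assms(1) unfolding metric_measure_def borel_regular_outer_measure_def
          outer_measure_space_def increasing_def by auto
    qed
    finally have le: "ennreal c * \<mu> (cball x ?r) \<le> \<mu> (cball x ?r)" .
    have pos: "\<mu> (cball x ?r) > 0" using assms(2) r0 by (simp add: fully_supported_def)
    have fin: "\<mu> (cball x ?r) < \<infinity>" using assms(1) by (simp add: metric_measure_def)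
    obtain m where m: "m \<ge> 0" "\<mu> (cball x ?r) = ennreal m"
      using fin by (metis ennreal_cases infinity_ennreal_def less_irrefl)
    with pos have "m > 0" by simp
    with le m c show False
      by (simp add: ennreal_mult[symmetric])
  qed
  moreover have "2 * \<tau> \<ge> 1" using \<tau> by simp
  ultimately show ?thesis unfolding uniformly_perfect_def by blast
qed

text \<open>The constants 4/3 and \<tau> do not depend on the point, so a weighted sum over a dense
  sequence keeps the inequality term by term. Density gives full support, and the weights are chosen
  for finiteness on bounded sets.\<close>

lemma reverse_doubling_measure_if_uniformly_perfect:
  assumes two_points: "\<exists>x y :: 'a::complete_space. x \<noteq> y"
    and doubling: "finitely_doubling TYPE('a)" and "uniformly_perfect TYPE('a)"
  shows "\<exists>\<mu> :: 'a set \<Rightarrow> ennreal. metric_measure \<mu> \<and> fully_supported \<mu> \<and> reverse_doubling \<mu>"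
proof -
  obtain C where C: "C \<ge> 1"
    and perfect: "\<And>(x::'a) r. r > 0 \<Longrightarrow> UNIV - cball x r \<noteq> {} \<Longrightarrow> cball x r - cball x (r / C) \<noteq> {}"
    using assms(3) unfolding uniformly_perfect_def by blast
  define \<tau> where "\<tau> = 1 + 128 * C\<^sup>2"
  have \<tau>: "\<tau> > 1" using C by (simp add: \<tau>_def)
  let ?admissible = "\<lambda>r. 0 < r \<and> ennreal r \<le> ediam TYPE('a) / ennreal (2 * \<tau>)"
  have "\<exists>M :: 'a measure. sets M = sets borel \<and> (\<forall>x R. emeasure M (cball x R) < \<infinity>) \<and>
      (\<forall>e>0. emeasure M (cball z e) > 0) \<and>
      (\<forall>x r. ?admissible r \<longrightarrow> ennreal (4 / 3) * emeasure M (cball x r) \<le> emeasure M (cball x (\<tau> * r)))"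
    for z :: 'a
  proof (cases "bounded (UNIV :: 'a set)")
    case True
    show ?thesis
      by (rule reverse_doubling_measure_at_bounded[OF two_points True C, of z], erule (1) perfect)
        (unfold \<tau>_def, blast)
  next
    case False
    show ?thesis
      by (rule reverse_doubling_measure_at_unbounded[OF False C, of z], erule (1) perfect)
        (unfold \<tau>_def, blast)
  qed
  then obtain L :: "'a \<Rightarrow> 'a measure" where L: "\<And>z. sets (L z) = sets borel"
    "\<And>z x R. emeasure (L z) (cball x R) < \<infinity>" "\<And>z e. e > 0 \<Longrightarrow> emeasure (L z) (cball z e) > 0"
    "\<And>z x r. ?admissible r \<Longrightarrow> ennreal (4 / 3) * emeasure (L z) (cball x r) \<le> emeasure (L z) (cball x (\<tau> * r))"
    by metis
  obtain z :: "nat \<Rightarrow> 'a" where dense: "\<And>x e. e > 0 \<Longrightarrow> \<exists>j. dist x (z j) \<le> e"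
    using finitely_doubling_dense_sequence[OF doubling] by blast
  let ?x0 = "z 0"
  \<comment> \<open>The ball grows with j: for fixed R, all terms with j \<ge> R are then dominated
    by a geometric series on B(x0, R). The weight divides by 1 + m because the mass m may be
    0.\<close>
  have "\<exists>w>0. ennreal w * emeasure (L (z j)) (cball ?x0 (real j)) \<le> ennreal ((1 / 2) ^ j)" for j
  proof -
    obtain m where m: "m \<ge> 0" "emeasure (L (z j)) (cball ?x0 (real j)) = ennreal m"
      using L(2)[of "z j" ?x0 "real j"] by (metis ennreal_cases infinity_ennreal_def less_irrefl)
    have "(1 / 2) ^ j / (1 + m) * m \<le> (1 / 2) ^ j"
      using mult_left_mono[of "m / (1 + m)" 1 "(1 / 2) ^ j"] m(1) by simp
    then have "ennreal ((1 / 2) ^ j / (1 + m)) * ennreal m \<le> ennreal ((1 / 2) ^ j)"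
      using m(1) by (subst ennreal_mult[symmetric]) (auto intro!: ennreal_leI)
    moreover have "(1 / 2) ^ j / (1 + m) > 0" using m(1) by simp
    ultimately show ?thesis unfolding m(2) by blast
  qed
  then obtain w where w: "\<And>j. w j > 0"
    "\<And>j. ennreal (w j) * emeasure (L (z j)) (cball ?x0 (real j)) \<le> ennreal ((1 / 2) ^ j)"
    by metis
  obtain M :: "'a measure" where M: "sets M = sets borel"
    "\<And>A. A \<in> sets borel \<Longrightarrow> emeasure M A = (\<Sum>j. ennreal (w j) * emeasure (L (z j)) A)"
    using countable_sum_measure[of "\<lambda>j. L (z j)" borel "\<lambda>j. ennreal (w j)"] L(1) by metis
  have M_cball: "emeasure M (cball x r) = (\<Sum>j. ennreal (w j) * emeasure (L (z j)) (cball x r))" for x r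
    by (rule M) simp
  have outer_cball: "outer_measure_of M (cball x r) = emeasure M (cball x r)" for x r
    by (rule outer_measure_of_eq) (simp add: M(1))
  have pos: "emeasure M (cball x r) > 0" if r: "r > 0" for x r
  proof -
    obtain j where j: "dist x (z j) \<le> r / 2" using dense[of "r / 2" x] r by auto
    have "0 < ennreal (w j) * emeasure (L (z j)) (cball (z j) (r / 2))"
      using w(1)[of j] L(3)[of "r / 2" "z j"] r by (simp add: ennreal_zero_less_mult_iff)
    also have "\<dots> = (\<Sum>k\<in>{j}. ennreal (w k) * emeasure (L (z k)) (cball (z j) (r / 2)))" by simp
    also have "\<dots> \<le> emeasure M (cball (z j) (r / 2))"
      unfolding M_cball by (intro sum_le_suminf) auto
    also have "\<dots> \<le> emeasure M (cball x r)"
    proof (intro emeasure_mono subsetI)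
      fix p assume "p \<in> cball (z j) (r / 2)"
      then show "p \<in> cball x r" using j dist_triangle[of x p "z j"] by simp
    qed (simp add: M(1))
    finally show ?thesis .
  qed
  have fin: "emeasure M (cball ?x0 R) < \<infinity>" for R
  proof -
    obtain m :: nat where m: "R \<le> m" using real_arch_simple by blast
    let ?t = "\<lambda>j. ennreal (w j) * emeasure (L (z j)) (cball ?x0 R)"
    \<comment> \<open>Separates the finitely many terms with j < m, each finite, from the
      geometrically bounded rest.\<close>
    let ?u = "\<lambda>j. if j < m then ?t j else 0"
    have "?t j \<le> ?u j + ennreal ((1 / 2) ^ j)" for j
    proof (cases "j < m")
      case False
      then have "R \<le> real j" using m by simp
      then have "emeasure (L (z j)) (cball ?x0 R) \<le> emeasure (L (z j)) (cball ?x0 (real j))"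
        by (intro emeasure_mono) (auto simp: L(1))
      then have "?t j \<le> ennreal (w j) * emeasure (L (z j)) (cball ?x0 (real j))"
        by (intro mult_left_mono) auto
      also note w(2)
      finally show ?thesis using False by simp
    qed simp
    then have "emeasure M (cball ?x0 R) \<le> (\<Sum>j. ?u j + ennreal ((1 / 2) ^ j))"
      unfolding M_cball by (intro suminf_le) auto
    also have "\<dots> = (\<Sum>j. ?u j) + (\<Sum>j. ennreal ((1 / 2) ^ j))"
      by (intro suminf_add[symmetric]) auto
    also have "(\<Sum>j. ?u j) = (\<Sum>j<m. ?u j)" by (rule suminf_finite) auto
    also have "(\<Sum>j. ennreal ((1 / 2) ^ j)) = ennreal (\<Sum>j. (1 / 2) ^ j)"
      by (intro suminf_ennreal2 summable_geometric) auto
    also have "(\<Sum>j<m. ?u j) + ennreal (\<Sum>j. (1 / 2) ^ j) < \<infinity>"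
      using L(2) by (auto simp: ennreal_mult_less_top)
    finally show ?thesis .
  qed
  have "metric_measure (outer_measure_of M)"
    unfolding metric_measure_def
  proof (intro conjI allI impI)
    show "borel_regular_outer_measure (outer_measure_of M)"
      using M(1) by (rule borel_regular_outer_measure_of)
    have "0 < outer_measure_of M (cball ?x0 1)" using pos[of 1 ?x0] by (simp add: outer_cball)
    also have "\<dots> \<le> outer_measure_of M UNIV" by (rule outer_measure_of_mono) simp
    finally show "outer_measure_of M UNIV \<noteq> 0" by simp
    show "outer_measure_of M A < \<infinity>" if "bounded A" for A
    proof -
      obtain R where "\<forall>p\<in>A. dist ?x0 p \<le> R"
        using \<open>bounded A\<close> unfolding bounded_any_center[of A ?x0] by blast
      then have "A \<subseteq> cball ?x0 R" by auto
      then have "outer_measure_of M A \<le> emeasure M (cball ?x0 R)"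
        unfolding outer_cball[symmetric] by (rule outer_measure_of_mono)
      with fin[of R] show ?thesis by order
    qed
  qed
  moreover have "fully_supported (outer_measure_of M)"
    unfolding fully_supported_def outer_cball using pos by blast
  moreover have "reverse_doubling (outer_measure_of M)"
    unfolding reverse_doubling_def outer_cball
  proof (rule exI[of _ "4 / 3"], rule exI[of _ \<tau>], intro conjI allI impI)
    fix x :: 'a and r assume r: "0 < r" "ennreal r \<le> ediam TYPE('a) / ennreal (2 * \<tau>)"
    have "ennreal (4 / 3) * (ennreal (w j) * emeasure (L (z j)) (cball x r))
        \<le> ennreal (w j) * emeasure (L (z j)) (cball x (\<tau> * r))" for j
      using mult_left_mono[OF L(4)[of r "z j" x], of "ennreal (w j)"] r by (simp add: mult.left_commute)
    then have "(\<Sum>j. ennreal (4 / 3) * (ennreal (w j) * emeasure (L (z j)) (cball x r)))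
        \<le> emeasure M (cball x (\<tau> * r))"
      unfolding M_cball by (intro suminf_le) auto
    then show "ennreal (4 / 3) * emeasure M (cball x r) \<le> emeasure M (cball x (\<tau> * r))"
      unfolding M_cball by simp
  qed (use \<tau> in auto)
  ultimately show ?thesis by blast
qed

theorem corollary3p3:
  assumes two_points: "\<exists>x y :: 'a::complete_space. x \<noteq> y"
    and doubling: "finitely_doubling TYPE('a)"
  shows "uniformly_perfect TYPE('a) \<longleftrightarrow>
    (\<exists>\<mu> :: 'a set \<Rightarrow> ennreal. metric_measure \<mu> \<and> fully_supported \<mu> \<and> reverse_doubling \<mu>)"
  using reverse_doubling_measure_if_uniformly_perfect[OF assms] uniformly_perfect_if_reverse_doubling
  by blast

end
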